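(* For $z\in\mathbb C$ and $x\in\mathbb C$ with $|x|<1$, define $$\mathcal O(z,x):=\sum_{n=0}^{\infty}\frac{\binom{2n}{n}}{4^n(2n+1)}\prod_{j=1}^{n}\left(1+\frac{z}{(2j-1)^2}\right)x^{2n+1},$$ $$\mathcal E(z,x):=\sum_{n=1}^{\infty}\frac{4^n}{n^2\binom{2n}{n}}\prod_{j=1}^{n-1}\left(1+\frac{z}{j^2}\right)x^{2n}.$$ Then $$\mathcal O(z,x)=\frac{\sinh(\sqrt z\,\arcsin x)}{\sqrt z},\qquad \mathcal E(z,x)=\frac{\cosh(2\sqrt z\,\arcsin x)-1}{z},$$ where the right-hand sides are understood through their power series in $z$ and hence are entire functions of $z$. Moreover, the two series converge normally for $z$ in compact subsets of $\mathbb C$ and $|x|\le r$, for each $r<1$.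
   Context: $\arcsin$ is the principal inverse sine, $\arcsin w=-i\operatorname{Log}(iw+\sqrt{1-w^2})$ with principal logarithm and principal square root. The power series in $z$ referred to are $\frac{\sinh(\sqrt z\,\theta)}{\sqrt z}=\sum_{m\ge0}\frac{\theta^{2m+1}}{(2m+1)!}z^m$ and $\frac{\cosh(2\sqrt z\,\theta)-1}{z}=\sum_{m\ge1}\frac{2^{2m}\theta^{2m}}{(2m)!}z^{m-1}$. *)

theory Defs
  imports "HOL-Analysis.Analysis"
begin

definition O_term :: "complex \<Rightarrow> complex \<Rightarrow> nat \<Rightarrow> complex" where
  "O_term z x n =
     of_nat ((2 * n) choose n) / (4 ^ n * (2 * of_nat n + 1))
     * (\<Prod>j=1..n. 1 + z / (2 * of_nat j - 1)\<^sup>2) * x ^ (2 * n + 1)"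

definition O_series :: "complex \<Rightarrow> complex \<Rightarrow> complex" where
  "O_series z x = (\<Sum>n. O_term z x n)"

definition E_term :: "complex \<Rightarrow> complex \<Rightarrow> nat \<Rightarrow> complex" where
  "E_term z x n =
     4 ^ n / (of_nat n ^ 2 * of_nat ((2 * n) choose n))
     * (\<Prod>j=1..<n. 1 + z / of_nat j ^ 2) * x ^ (2 * n)"

(* The sum over n \<ge> 1 is indexed by n = Suc k. *)
definition E_series :: "complex \<Rightarrow> complex \<Rightarrow> complex" where
  "E_series z x = (\<Sum>k. E_term z x (Suc k))"

(* sinh (sqrt z * t) / sqrt z as a power series in z, so that it also has a
   meaning at z = 0 and does not depend on a branch of the square root. *)
definition sinh_sqrt_quot :: "complex \<Rightarrow> complex \<Rightarrow> complex" where
  "sinh_sqrt_quot t z = (\<Sum>m. t ^ (2 * m + 1) / fact (2 * m + 1) * z ^ m)"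

(* (cosh (2 * sqrt z * t) - 1) / z as a power series in z; the sum over m \<ge> 1 of
   2^(2m) t^(2m) / (2m)! z^(m-1) is indexed by m = Suc k. *)
definition cosh_sqrt_quot :: "complex \<Rightarrow> complex \<Rightarrow> complex" where
  "cosh_sqrt_quot t z =
     (\<Sum>k. 2 ^ (2 * Suc k) * t ^ (2 * Suc k) / fact (2 * Suc k) * z ^ k)"

(* The sum of the sup norms over S is finite.  Both the suprema and the sum are taken
   in ennreal, so unbounded terms give the value top and an empty S gives 0. *)
definition normally_convergent_on ::
    "'a set \<Rightarrow> (nat \<Rightarrow> 'a \<Rightarrow> 'b::real_normed_vector) \<Rightarrow> bool" where
  "normally_convergent_on S f \<longleftrightarrow> (\<Sum>n. SUP s\<in>S. ennreal (norm (f n s))) < top"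

lemma sinh_sums_odd:
  "(\<lambda>m. w ^ (2 * m + 1) / fact (2 * m + 1)) sums sinh (w::complex)"
proof -
  have "(\<lambda>n. if even n then 0 else w ^ n /\<^sub>R fact n) sums sinh w"
    by (rule sinh_converges)
  moreover have "(\<lambda>m. (if even (2 * m + 1) then 0 else w ^ (2 * m + 1) /\<^sub>R fact (2 * m + 1)))
      sums s \<longleftrightarrow> (\<lambda>n. if even n then 0 else w ^ n /\<^sub>R fact n) sums s" for s
    by (rule sums_mono_reindex[where g = "\<lambda>m. 2 * m + 1"])
       (auto simp: strict_mono_def elim!: oddE)
  ultimately show ?thesis
    by (simp add: scaleR_conv_of_real field_simps)
qed

lemma cosh_sums_even:
  "(\<lambda>m. w ^ (2 * m) / fact (2 * m)) sums cosh (w::complex)"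
proof -
  have "(\<lambda>n. if even n then w ^ n /\<^sub>R fact n else 0) sums cosh w"
    by (rule cosh_converges)
  moreover have "(\<lambda>m. (if even (2 * m) then w ^ (2 * m) /\<^sub>R fact (2 * m) else 0))
      sums s \<longleftrightarrow> (\<lambda>n. if even n then w ^ n /\<^sub>R fact n else 0) sums s" for s
    by (rule sums_mono_reindex[where g = "\<lambda>m. 2 * m"])
       (auto simp: strict_mono_def elim!: evenE)
  ultimately show ?thesis
    by (simp add: scaleR_conv_of_real field_simps)
qed

lemma sinh_sqrt_quot_sums:
  fixes s t z :: complex
  assumes "s\<^sup>2 = z" "z \<noteq> 0"
  shows "(\<lambda>m. t ^ (2 * m + 1) / fact (2 * m + 1) * z ^ m) sums (sinh (s * t) / s)"
proof -
  have "(\<lambda>m. (s * t) ^ (2 * m + 1) / fact (2 * m + 1) / s) sums (sinh (s * t) / s)"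
    by (intro sums_divide sinh_sums_odd)
  moreover have "(s * t) ^ (2 * m + 1) / fact (2 * m + 1) / s
      = t ^ (2 * m + 1) / fact (2 * m + 1) * z ^ m" for m
    using assms by (auto simp: power_mult_distrib power_mult)
  ultimately show ?thesis by simp
qed

lemma sinh_sqrt_quot_eq:
  "s\<^sup>2 = z \<Longrightarrow> z \<noteq> 0 \<Longrightarrow> sinh_sqrt_quot t z = sinh (s * t) / s"
  unfolding sinh_sqrt_quot_def using sinh_sqrt_quot_sums by (rule sums_unique[symmetric])

lemma sinh_sqrt_quot_0: "sinh_sqrt_quot t 0 = t"
  unfolding sinh_sqrt_quot_def by (subst powser_zero) simp

lemma cosh_sqrt_quot_sums:
  fixes s t z :: complex
  assumes "s\<^sup>2 = z" "z \<noteq> 0"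
  shows "(\<lambda>k. 2 ^ (2 * Suc k) * t ^ (2 * Suc k) / fact (2 * Suc k) * z ^ k)
           sums ((cosh (2 * s * t) - 1) / z)"
proof -
  have "(\<lambda>k. (2 * s * t) ^ (2 * Suc k) / fact (2 * Suc k)) sums (cosh (2 * s * t) - 1)"
    using cosh_sums_even[of "2 * s * t"]
    by (subst sums_Suc_iff) simp
  hence "(\<lambda>k. (2 * s * t) ^ (2 * Suc k) / fact (2 * Suc k) / z) sums ((cosh (2 * s * t) - 1) / z)"
    by (rule sums_divide)
  moreover have "(2 * s * t) ^ (2 * Suc k) / fact (2 * Suc k) / z
      = 2 ^ (2 * Suc k) * t ^ (2 * Suc k) / fact (2 * Suc k) * z ^ k" for k
  proof -
    have "(2 * s * t) ^ (2 * Suc k) = 2 ^ (2 * Suc k) * t ^ (2 * Suc k) * (s\<^sup>2) ^ Suc k"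
      by (simp only: power_mult_distrib power_mult[of s] mult.assoc mult.left_commute mult.commute[of "s\<^sup>2 ^ Suc k"])
    also have "(s\<^sup>2) ^ Suc k = z ^ k * z"
      using assms(1) by simp
    finally show ?thesis
      using assms(2) by (simp only:) (simp add: divide_simps)
  qed
  ultimately show ?thesis by simp
qed

lemma cosh_sqrt_quot_eq:
  "s\<^sup>2 = z \<Longrightarrow> z \<noteq> 0 \<Longrightarrow> cosh_sqrt_quot t z = (cosh (2 * s * t) - 1) / z"
  unfolding cosh_sqrt_quot_def using cosh_sqrt_quot_sums by (rule sums_unique[symmetric])

lemma cosh_sqrt_quot_0: "cosh_sqrt_quot t 0 = 2 * t\<^sup>2"
  unfolding cosh_sqrt_quot_def by (subst powser_zero) (simp add: power2_eq_square)

end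

theory Submission
  imports Defs "HOL-Complex_Analysis.Complex_Analysis"
begin

text \<open>
  Write \<open>S\<close> for the function \<open>t \<mapsto> sinh (\<surd>z t) / \<surd>z\<close>. Since
  \<open>d\<^sup>2/dt\<^sup>2\<close> becomes \<open>(1 - x\<^sup>2) d\<^sup>2/dx\<^sup>2 - x d/dx\<close> under \<open>t = arcsin x\<close>, a solution of
  \<open>g'' = w g + c\<close> yields a holomorphic function \<open>f = g \<circ> arcsin\<close> on the unit disc with
  \<open>(1 - x\<^sup>2) f'' - x f' = w f + c\<close>. Comparing Taylor coefficients gives a two-step recurrence
  whose solution is a product; \<open>S\<close> satisfies \<open>S'' = z S\<close> and leads to the first series, while
  \<open>(cosh (2 \<surd>z t) - 1) / z\<close> is \<open>2 S\<^sup>2\<close>, satisfies \<open>g'' = 4 z g + 4\<close>, and leads to the second.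
  The terms of both series are dominated by their values at \<open>z = R\<close>, \<open>x = r\<close>,
  so normal convergence follows from convergence at that one point.
\<close>

section \<open>Taylor coefficients of compositions with \<open>Arcsin\<close>\<close>

text \<open>Compare coefficients of \<open>x ^ n\<close> in the equation: \<open>f''\<close>
  contributes \<open>(n + 2) * (n + 1) * a (n + 2)\<close>, while \<open>x\<^sup>2 f''\<close> and
  \<open>x f'\<close> contribute \<open>n * (n - 1) * a n\<close> and \<open>n * a n\<close>,
  together \<open>n ^ 2 * a n\<close>. The constant \<open>c\<close> is seen only at
  \<open>n = 0\<close>. Formal power series and uniqueness of expansions make this rigorous.\<close>

lemma taylor_coeff_recurrence:
  fixes f :: "complex \<Rightarrow> complex" and w c :: complex
  defines "a \<equiv> \<lambda>n. (deriv ^^ n) f 0 / fact n"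
  assumes holo: "f holomorphic_on ball 0 r" and "r > 0"
    and ode: "\<And>x. x \<in> ball 0 r \<Longrightarrow>
      (1 - x\<^sup>2) * deriv (deriv f) x - x * deriv f x = w * f x + c"
  shows "of_nat (n + 2) * of_nat (n + 1) * a (n + 2)
           = (of_nat n ^ 2 + w) * a n + (if n = 0 then c else 0)"
proof -
  define F where "F = fps_expansion f 0"
  have F: "f has_fps_expansion F"
    unfolding F_def using holo \<open>r > 0\<close> by (intro has_fps_expansion_fps_expansion[of "ball 0 r"]) auto
  have nth: "fps_nth F n = a n" for n
    using fps_nth_fps_expansion[OF F] by (simp add: a_def)
  have ode_ev: "eventually (\<lambda>x. (1 - x ^ 2) * deriv (deriv f) x - x * deriv f x = w * f x + c) (nhds 0)"
    using eventually_nhds_in_open[of "ball 0 r" "0 :: complex"] \<open>r > 0\<close>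
    by (auto elim!: eventually_mono simp: ode)
  have L: "(\<lambda>x. (1 - x ^ 2) * deriv (deriv f) x - x * deriv f x) has_fps_expansion
             ((1 - fps_X ^ 2) * fps_deriv (fps_deriv F) - fps_X * fps_deriv F)"
    by (intro fps_expansion_intros F)
  have R: "(\<lambda>x. w * f x + c) has_fps_expansion (fps_const w * F + fps_const c)"
    by (intro fps_expansion_intros F)
  have "(\<lambda>x. w * f x + c) has_fps_expansion
             ((1 - fps_X ^ 2) * fps_deriv (fps_deriv F) - fps_X * fps_deriv F)"
    using L has_fps_expansion_cong[OF ode_ev refl] by blast
  hence eq: "(1 - fps_X ^ 2) * fps_deriv (fps_deriv F) - fps_X * fps_deriv F
               = fps_const w * F + fps_const c"
    using R fps_expansion_unique_complex by blast
  have "fps_nth ((1 - fps_X ^ 2) * fps_deriv (fps_deriv F) - fps_X * fps_deriv F) n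
      = of_nat (n + 2) * of_nat (n + 1) * a (n + 2) - of_nat n ^ 2 * a n"
  \<comment> \<open>Multiplication by \<open>fps_X ^ 2\<close> shifts indices by two, so below 2 its
    coefficients are 0, in agreement with \<open>n * (n - 1) = 0\<close>.\<close>
  proof (cases "n < 2")
    case True
    hence "n = 0 \<or> n = 1" by auto
    thus ?thesis
      by (auto simp: nth algebra_simps fps_X_power_mult_nth)
  next
    case False
    then obtain m where m: "n = Suc (Suc m)"
      by (metis add_2_eq_Suc le_Suc_ex not_less)
    show ?thesis unfolding m
      by (simp add: nth left_diff_distrib fps_X_power_mult_nth)
         (simp add: algebra_simps power2_eq_square)
  qed
  moreover have "fps_nth (fps_const w * F + fps_const c) n = w * a n + (if n = 0 then c else 0)"
    by (simp add: nth)
  ultimately have "of_nat (n + 2) * of_nat (n + 1) * a (n + 2) - of_nat n ^ 2 * a n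
      = w * a n + (if n = 0 then c else 0)"
    by (simp only: eq)
  thus ?thesis
    by (simp only: diff_eq_eq distrib_right add_ac)
qed

text \<open>Chain rule twice, with \<open>Arcsin' x = 1 / cos (Arcsin x)\<close> and
  \<open>(cos (Arcsin x))\<^sup>2 = 1 - x\<^sup>2\<close>. The second-order equation for
  \<open>g\<close> is stated as a first-order system in \<open>g\<close> and \<open>g'\<close>, so
  that explicit derivatives can be supplied.\<close>

lemma ode_comp_Arcsin:
  fixes g g' :: "complex \<Rightarrow> complex"
  assumes g: "\<And>t. (g has_field_derivative g' t) (at t)"
    and g': "\<And>t. (g' has_field_derivative w * g t + c) (at t)"
  defines "f \<equiv> \<lambda>x. g (Arcsin x)"
  shows "f holomorphic_on ball 0 1"
    and "deriv f 0 = g' 0"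
    and "x \<in> ball 0 1 \<Longrightarrow> (1 - x\<^sup>2) * deriv (deriv f) x - x * deriv f x = w * f x + c"
proof -
  \<comment> \<open>The branch cuts of \<open>Arcsin\<close> lie on the real axis where the absolute
    value is at least 1, hence outside the open disc.\<close>
  have arc: "(Arcsin has_field_derivative inverse (cos (Arcsin x))) (at x)" if "x \<in> ball 0 1" for x
    using that abs_Re_le_cmod[of x] by (intro has_field_derivative_Arcsin) auto
  have cos_nz: "cos (Arcsin x) \<noteq> 0" if "x \<in> ball 0 1" for x
  proof (rule cos_Arcsin_nonzero)
    show "x\<^sup>2 \<noteq> 1"
      using that by (auto simp: power2_eq_1_iff)
  qed
  have df: "(f has_field_derivative g' (Arcsin x) / cos (Arcsin x)) (at x)" if "x \<in> ball 0 1" for x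
    unfolding f_def using DERIV_chain2[OF g arc[OF that]] by (simp add: divide_inverse)
  show "f holomorphic_on ball 0 1"
    unfolding holomorphic_on_open[OF open_ball] using df by blast
  show "deriv f 0 = g' 0"
    using DERIV_imp_deriv[OF df[of 0]] by simp
  show "(1 - x\<^sup>2) * deriv (deriv f) x - x * deriv f x = w * f x + c" if x: "x \<in> ball 0 1"
  proof -
    let ?u = "Arcsin x"
    \<comment> \<open>Differentiating \<open>deriv f\<close> at \<open>x\<close> requires its
      formula on a neighbourhood of \<open>x\<close>, not only at the point.\<close>
    have ev: "eventually (\<lambda>y. g' (Arcsin y) / cos (Arcsin y) = deriv f y) (nhds x)"
      using eventually_nhds_in_open[OF open_ball x]
      by (rule eventually_mono) (metis DERIV_imp_deriv df)
    have "((\<lambda>y. g' (Arcsin y) / cos (Arcsin y)) has_field_derivative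
            ((w * g ?u + c) * inverse (cos ?u) * cos ?u
              - g' ?u * (- sin ?u * inverse (cos ?u))) / (cos ?u * cos ?u)) (at x)"
      by (intro DERIV_divide DERIV_chain2[OF g' arc[OF x]] DERIV_chain2[OF DERIV_cos arc[OF x]]
            cos_nz x)
    hence "deriv (deriv f) x = ((w * g ?u + c) * inverse (cos ?u) * cos ?u
              - g' ?u * (- sin ?u * inverse (cos ?u))) / (cos ?u * cos ?u)"
      using DERIV_cong_ev[OF refl ev refl] by (blast intro: DERIV_imp_deriv)
    also have "\<dots> = (w * f x + c + x * deriv f x) / (cos ?u)\<^sup>2"
      using cos_nz[OF x] DERIV_imp_deriv[OF df[OF x]]
      by (simp add: field_simps power2_eq_square f_def)
    also have "(cos ?u)\<^sup>2 = 1 - x\<^sup>2"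
      by (simp add: cos_squared_eq)
    moreover have "1 - x\<^sup>2 \<noteq> 0"
      using cos_nz[OF x] by (metis cos_squared_eq sin_Arcsin zero_eq_power2)
    ultimately show ?thesis
      by (simp add: field_simps)
  qed
qed

text \<open>Holomorphy on the unit disc makes the Taylor series at 0 converge on all of it, so
  summability of the two series comes for free. The coefficients stay abstract because the two
  initial values and the recurrence determine them.\<close>

lemma Arcsin_comp_coeffs:
  fixes g g' :: "complex \<Rightarrow> complex"
  assumes "\<And>t. (g has_field_derivative g' t) (at t)"
    and "\<And>t. (g' has_field_derivative w * g t + c) (at t)"
  obtains a where "a 0 = g 0" "a 1 = g' 0"
    "\<And>n. of_nat (n + 2) * of_nat (n + 1) * a (n + 2)
           = (of_nat n ^ 2 + w) * a n + (if n = 0 then c else 0)"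
    "\<And>x. norm x < 1 \<Longrightarrow> (\<lambda>n. a n * x ^ n) sums g (Arcsin x)"
proof
  let ?f = "\<lambda>x. g (Arcsin x)"
  let ?a = "\<lambda>n. (deriv ^^ n) ?f 0 / fact n"
  note f = ode_comp_Arcsin[OF assms]
  show "?a 0 = g 0" "?a 1 = g' 0"
    using f(2) by simp_all
  show "of_nat (n + 2) * of_nat (n + 1) * ?a (n + 2)
           = (of_nat n ^ 2 + w) * ?a n + (if n = 0 then c else 0)" for n
    by (rule taylor_coeff_recurrence[OF f(1) zero_less_one f(3)])
  show "(\<lambda>n. ?a n * x ^ n) sums g (Arcsin x)" if "norm x < 1" for x
    using holomorphic_power_series[OF f(1), of x] that by simp
qed

section \<open>The differential equations in \<open>t\<close>\<close>

text \<open>The \<open>t\<close>-derivative of \<open>sinh_sqrt_quot t z\<close>. As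
  \<open>cosh\<close> is even, the choice of square root does not matter, and \<open>z = 0\<close>
  gives the correct value 1.\<close>

definition cosh_sqrt :: "complex \<Rightarrow> complex \<Rightarrow> complex" where
  "cosh_sqrt t z = cosh (csqrt z * t)"

text \<open>The closed form divides by \<open>csqrt z\<close>, so \<open>z = 0\<close> is treated
  apart; there the function is \<open>t\<close> itself.\<close>

lemma DERIV_sinh_sqrt_quot:
  "((\<lambda>t. sinh_sqrt_quot t z) has_field_derivative cosh_sqrt t z) (at t)"
proof (cases "z = 0")
  case True
  thus ?thesis by (simp add: sinh_sqrt_quot_0 cosh_sqrt_def)
next
  case False
  have "((\<lambda>t. sinh (csqrt z * t) / csqrt z) has_field_derivative cosh (csqrt z * t)) (at t)"
    using False by (auto intro!: derivative_eq_intros)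
  thus ?thesis
    using False by (simp add: sinh_sqrt_quot_eq[of "csqrt z"] cosh_sqrt_def)
qed

lemma DERIV_cosh_sqrt:
  "((\<lambda>t. cosh_sqrt t z) has_field_derivative z * sinh_sqrt_quot t z) (at t)"
proof (cases "z = 0")
  case True
  thus ?thesis by (simp add: cosh_sqrt_def)
next
  case False
  have "((\<lambda>t. cosh (csqrt z * t)) has_field_derivative csqrt z * sinh (csqrt z * t)) (at t)"
    by (auto intro!: derivative_eq_intros)
  also have "csqrt z * sinh (csqrt z * t) = (csqrt z)\<^sup>2 * (sinh (csqrt z * t) / csqrt z)"
    using False by (simp add: power2_eq_square)
  finally show ?thesis
    using False by (simp add: sinh_sqrt_quot_eq[of "csqrt z"] cosh_sqrt_def)
qed

lemma cosh_sqrt_square: "(cosh_sqrt t z)\<^sup>2 = 1 + z * (sinh_sqrt_quot t z)\<^sup>2"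
proof (cases "z = 0")
  case False
  have "z * (sinh (csqrt z * t) / csqrt z)\<^sup>2 = (sinh (csqrt z * t))\<^sup>2"
    using False by (simp add: power_divide)
  thus ?thesis
    using False by (simp add: sinh_sqrt_quot_eq[of "csqrt z"] cosh_sqrt_def cosh_square_eq)
qed (simp add: cosh_sqrt_def)

text \<open>Double-argument formula \<open>cosh (2 * u) = 1 + 2 * (sinh u)\<^sup>2\<close>. It
  reduces derivatives and holomorphy of \<open>cosh_sqrt_quot\<close> to those of
  \<open>sinh_sqrt_quot\<close>.\<close>

lemma cosh_sqrt_quot_conv_sinh_sqrt_quot:
  "cosh_sqrt_quot t z = 2 * (sinh_sqrt_quot t z)\<^sup>2"
proof (cases "z = 0")
  case False
  have "cosh (2 * csqrt z * t) - 1 = 2 * (sinh (csqrt z * t))\<^sup>2"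
    using cosh_double[of "csqrt z * t"] by (simp add: cosh_square_eq mult.assoc)
  thus ?thesis
    using False
    by (simp add: sinh_sqrt_quot_eq[of "csqrt z"] cosh_sqrt_quot_eq[of "csqrt z"] power_divide)
qed (simp add: cosh_sqrt_quot_0 sinh_sqrt_quot_0)

lemma DERIV_cosh_sqrt_quot:
  "((\<lambda>t. cosh_sqrt_quot t z) has_field_derivative 4 * (sinh_sqrt_quot t z * cosh_sqrt t z)) (at t)"
  unfolding cosh_sqrt_quot_conv_sinh_sqrt_quot
  by (auto intro!: derivative_eq_intros DERIV_sinh_sqrt_quot)

text \<open>With \<open>S\<close> and \<open>C\<close> for the sinh quotient and
  \<open>cosh_sqrt\<close>, the product rule gives \<open>4 * (C\<^sup>2 + z * S\<^sup>2)\<close>.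
  Since \<open>C\<^sup>2 = 1 + z * S\<^sup>2\<close>, this is
  \<open>4 + 4 * z * (2 * S\<^sup>2)\<close>.\<close>

lemma DERIV_cosh_sqrt_quot':
  "((\<lambda>t. 4 * (sinh_sqrt_quot t z * cosh_sqrt t z)) has_field_derivative
     4 * z * cosh_sqrt_quot t z + 4) (at t)"
proof -
  have "((\<lambda>t. 4 * (sinh_sqrt_quot t z * cosh_sqrt t z)) has_field_derivative
          4 * ((cosh_sqrt t z)\<^sup>2 + z * (sinh_sqrt_quot t z)\<^sup>2)) (at t)"
    by (auto intro!: derivative_eq_intros DERIV_sinh_sqrt_quot DERIV_cosh_sqrt
          simp: power2_eq_square algebra_simps)
  thus ?thesis
    by (simp add: cosh_sqrt_square cosh_sqrt_quot_conv_sinh_sqrt_quot algebra_simps)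
qed

section \<open>Ratios of consecutive terms\<close>

text \<open>The absorption identity is applied twice; in between, the two equal middle entries of
  row \<open>2 * n + 1\<close> are exchanged.\<close>

lemma central_binomial_Suc:
  "Suc n * ((2 * Suc n) choose Suc n) = 2 * (2 * n + 1) * ((2 * n) choose n)"
proof -
  have sym: "Suc (2 * n) choose n = Suc (2 * n) choose Suc n"
    using binomial_symmetric[of n "Suc (2 * n)"] by (simp add: Suc_diff_le)
  have "Suc n * ((2 * Suc n) choose Suc n) = 2 * (Suc n * (Suc (2 * n) choose Suc n))"
    using Suc_times_binomial[of n "Suc (2 * n)"] unfolding sym by simp
  also have "Suc n * (Suc (2 * n) choose Suc n) = Suc (2 * n) * ((2 * n) choose n)"
    by (rule Suc_times_binomial)
  finally show ?thesis by simp
qed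

lemma central_binomial_Suc_field:
  "of_nat ((2 * Suc n) choose Suc n)
     = 2 * (2 * of_nat n + 1) / (of_nat n + 1) * (of_nat ((2 * n) choose n) :: 'a :: field_char_0)"
proof -
  have "(of_nat (Suc n * ((2 * Suc n) choose Suc n)) :: 'a)
          = of_nat (2 * (2 * n + 1) * ((2 * n) choose n))"
    by (simp only: central_binomial_Suc)
  moreover have "(of_nat n + 1 :: 'a) \<noteq> 0"
    by (metis of_nat_Suc of_nat_neq_0 add.commute)
  ultimately show ?thesis
    by (simp add: field_simps del: mult_Suc_right binomial_Suc_Suc)
qed

lemma of_nat_denoms_nonzero [simp]:
  "of_nat n + 1 \<noteq> (0 :: 'a :: field_char_0)"
  "2 * of_nat n + 1 \<noteq> (0 :: 'a)" "2 * of_nat n + 2 \<noteq> (0 :: 'a)" "2 * of_nat n + 3 \<noteq> (0 :: 'a)"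
  using of_nat_neq_0[of n, where ?'a = 'a] of_nat_neq_0[of "2 * n", where ?'a = 'a]
    of_nat_neq_0[of "2 * n + 1", where ?'a = 'a] of_nat_neq_0[of "2 * n + 2", where ?'a = 'a]
  by (simp_all add: algebra_simps)

text \<open>With \<open>m = 2 * n + 1\<close> the ratio is
  \<open>(m\<^sup>2 + z) / ((m + 1) * (m + 2))\<close> times \<open>x\<^sup>2\<close>, exactly the
  Taylor recurrence with \<open>w = z\<close>.\<close>

lemma O_term_Suc:
  "O_term z x (Suc n) = ((2 * of_nat n + 1)\<^sup>2 + z) / ((2 * of_nat n + 2) * (2 * of_nat n + 3))
     * x\<^sup>2 * O_term z x n"
proof -
  let ?k = "of_nat n :: complex"
  have prod: "(\<Prod>j=1..Suc n. 1 + z / (2 * of_nat j - 1)\<^sup>2)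
      = (1 + z / (2 * ?k + 1)\<^sup>2) * (\<Prod>j=1..n. 1 + z / (2 * of_nat j - 1)\<^sup>2)"
    by (simp add: algebra_simps)
  define P where "P = (\<Prod>j=1..n. 1 + z / (2 * of_nat j - 1)\<^sup>2)"
  define B where "B = (of_nat ((2 * n) choose n) :: complex)"
  \<comment> \<open>Here \<open>u\<close>, \<open>v\<close>, \<open>y\<close> stand for
    \<open>n + 1\<close>, \<open>2 * n + 1\<close>, \<open>2 * n + 3\<close>, and \<open>F\<close>
    for \<open>4 ^ n\<close>. Abstract variables keep the simplifier from expanding powers, product
    and binomial.\<close>
  have rearrange: "(2 * v / u * B) / (4 * F * y) * ((1 + q) * P) * (X * Y)
      = (v * (1 + q) * v) / ((2 * u) * y) * X * (B / (F * v) * P * Y)"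
    if "u \<noteq> 0" "v \<noteq> 0" "y \<noteq> 0" "F \<noteq> 0" for u v y F q X Y :: complex
    using that by (simp add: field_simps)
  have "O_term z x (Suc n) = (2 * (2 * ?k + 1) / (?k + 1) * B) / (4 * 4 ^ n * (2 * ?k + 3))
     * ((1 + z / (2 * ?k + 1)\<^sup>2) * P) * (x ^ 2 * x ^ (2 * n + 1))"
    unfolding O_term_def central_binomial_Suc_field prod P_def B_def
    by (simp add: algebra_simps power2_eq_square)
  also have "\<dots> = ((2 * ?k + 1) * (1 + z / (2 * ?k + 1)\<^sup>2) * (2 * ?k + 1)) / ((2 * (?k + 1)) * (2 * ?k + 3))
     * x\<^sup>2 * (B / (4 ^ n * (2 * ?k + 1)) * P * x ^ (2 * n + 1))"
    by (rule rearrange) auto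
  also have "(2 * ?k + 1) * (1 + z / (2 * ?k + 1)\<^sup>2) * (2 * ?k + 1) = (2 * ?k + 1)\<^sup>2 + z"
    using of_nat_denoms_nonzero(2)[of n, where ?'a = complex] 
    by (simp add: divide_simps power2_eq_square)
  finally show ?thesis
    by (simp add: O_term_def P_def B_def)
qed

text \<open>The Taylor recurrence at the even index \<open>2 * n\<close> with
  \<open>w = 4 * z\<close>. At \<open>n = 0\<close> division by zero makes \<open>E_term\<close>
  equal to 0, whereas \<open>E_term z x 1\<close> is \<open>2 * x\<^sup>2\<close>; hence the start
  at 1.\<close>

lemma E_term_Suc:
  assumes "n > 0"
  shows "E_term z x (Suc n) = (4 * (of_nat n)\<^sup>2 + 4 * z) / ((2 * of_nat n + 1) * (2 * of_nat n + 2))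
     * x\<^sup>2 * E_term z x n"
proof -
  let ?k = "of_nat n :: complex"
  have prod: "(\<Prod>j=1..<Suc n. 1 + z / (of_nat j)\<^sup>2)
      = (1 + z / ?k\<^sup>2) * (\<Prod>j=1..<n. 1 + z / (of_nat j)\<^sup>2)"
    using assms by (simp add: prod.atLeastLessThan_Suc)
  define P where "P = (\<Prod>j=1..<n. 1 + z / (of_nat j)\<^sup>2)"
  define B where "B = (of_nat ((2 * n) choose n) :: complex)"
  have B: "B \<noteq> 0" and k: "?k \<noteq> 0"
    using assms by (simp_all add: B_def)
  \<comment> \<open>Used with \<open>u = n + 1\<close>, \<open>v = 2 * n + 1\<close>,
    \<open>m = n\<^sup>2\<close> and \<open>F = 4 ^ n\<close>.\<close>
  have rearrange: "4 * F / (u\<^sup>2 * (2 * v / u * B)) * ((1 + q) * P) * (X * Y)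
      = (4 * m * (1 + q)) / (v * (2 * u)) * X * (F / (m * B) * P * Y)"
    if "u \<noteq> 0" "v \<noteq> 0" "m \<noteq> 0" for u v m F q X Y :: complex
    using that B by (simp add: field_simps power2_eq_square)
  have "E_term z x (Suc n) = 4 * 4 ^ n / ((?k + 1)\<^sup>2 * (2 * (2 * ?k + 1) / (?k + 1) * B))
     * ((1 + z / ?k\<^sup>2) * P) * (x ^ 2 * x ^ (2 * n))"
    unfolding E_term_def central_binomial_Suc_field prod P_def B_def
    by (simp add: algebra_simps power2_eq_square)
  also have "\<dots> = (4 * ?k\<^sup>2 * (1 + z / ?k\<^sup>2)) / ((2 * ?k + 1) * (2 * (?k + 1)))
     * x\<^sup>2 * (4 ^ n / (?k\<^sup>2 * B) * P * x ^ (2 * n))"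
    using k by (intro rearrange) auto
  also have "4 * ?k\<^sup>2 * (1 + z / ?k\<^sup>2) = 4 * ?k\<^sup>2 + 4 * z"
    using k by (simp add: field_simps)
  finally show ?thesis
    by (simp add: E_term_def P_def B_def)
qed

section \<open>Summation of the two series\<close>

text \<open>Here \<open>c = 0\<close>, and the recurrence steps by two: \<open>a 0 = 0\<close> kills
  all even coefficients, and \<open>a 1 = 1\<close> starts the odd ones, which obey the ratio of
  \<open>O_term_Suc\<close>.\<close>

lemma O_term_sums:
  assumes x: "norm x < 1"
  shows "(\<lambda>n. O_term z x n) sums sinh_sqrt_quot (Arcsin x) z"
proof -
  have S0: "sinh_sqrt_quot 0 z = 0" and C0: "cosh_sqrt 0 z = 1"
    by (simp_all add: sinh_sqrt_quot_def cosh_sqrt_def)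
  have deriv': "((\<lambda>t. cosh_sqrt t z) has_field_derivative z * sinh_sqrt_quot t z + 0) (at t)" for t
    using DERIV_cosh_sqrt by simp
  obtain a where a0: "a 0 = 0" and a1: "a 1 = 1"
    and rec: "\<And>n. of_nat (n + 2) * of_nat (n + 1) * a (n + 2)
           = (of_nat n ^ 2 + z) * a n + (if n = 0 then 0 else 0)"
    and sums: "\<And>x. norm x < 1 \<Longrightarrow> (\<lambda>n. a n * x ^ n) sums sinh_sqrt_quot (Arcsin x) z"
    using Arcsin_comp_coeffs[OF DERIV_sinh_sqrt_quot deriv'] unfolding S0 C0 by blast
  have even: "a (2 * n) = 0" for n
  proof (induction n)
    case (Suc n)
    have "of_nat (2 * n + 2) * of_nat (2 * n + 1) * a (2 * n + 2) = 0"
      using rec[of "2 * n"] Suc by simp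
    hence "a (2 * n + 2) = 0"
      unfolding mult_eq_0_iff of_nat_eq_0_iff by simp
    thus ?case by simp
  qed (use a0 in simp)
  have odd: "a (2 * n + 1) * x ^ (2 * n + 1) = O_term z x n" for n
  proof (induction n)
    case 0
    show ?case using a1 by (simp add: O_term_def)
  next
    case (Suc n)
    have "(2 * of_nat n + 2) * (2 * of_nat n + 3) * a (2 * Suc n + 1)
            = ((2 * of_nat n + 1)\<^sup>2 + z) * a (2 * n + 1)"
      using rec[of "2 * n + 1"] by (simp add: algebra_simps)
    hence "a (2 * Suc n + 1) = ((2 * of_nat n + 1)\<^sup>2 + z)
        / ((2 * of_nat n + 2) * (2 * of_nat n + 3)) * a (2 * n + 1)"
      using of_nat_denoms_nonzero(3,4)[of n, where ?'a = complex]
      by (simp add: eq_divide_eq mult_ac del: mult_Suc_right)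
    hence "a (2 * Suc n + 1) * x ^ (2 * Suc n + 1) = ((2 * of_nat n + 1)\<^sup>2 + z)
        / ((2 * of_nat n + 2) * (2 * of_nat n + 3)) * x\<^sup>2 * (a (2 * n + 1) * x ^ (2 * n + 1))"
      by (simp add: power2_eq_square mult_ac)
    thus ?case
      unfolding Suc.IH O_term_Suc .
  qed
  have "(\<lambda>n. a (2 * n + 1) * x ^ (2 * n + 1)) sums sinh_sqrt_quot (Arcsin x) z"
  proof (subst sums_mono_reindex[of "\<lambda>n. 2 * n + 1" "\<lambda>n. a n * x ^ n"])
    show "a n * x ^ n = 0" if "n \<notin> range (\<lambda>n. 2 * n + 1)" for n
      using that even by (cases "even n") (auto elim!: evenE oddE)
  qed (use sums[OF x] in \<open>auto simp: strict_mono_def\<close>)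
  thus ?thesis
    unfolding odd .
qed

text \<open>Both initial values vanish, so the odd coefficients are 0 and the even ones are
  generated solely by the constant \<open>c = 4\<close>.\<close>

lemma E_term_sums:
  assumes x: "norm x < 1"
  shows "(\<lambda>k. E_term z x (Suc k)) sums cosh_sqrt_quot (Arcsin x) z"
proof -
  have S0: "sinh_sqrt_quot 0 z = 0"
    by (simp add: sinh_sqrt_quot_def)
  hence C0: "cosh_sqrt_quot 0 z = 0"
    by (simp add: cosh_sqrt_quot_conv_sinh_sqrt_quot)
  obtain a where a0: "a 0 = 0" and a1: "a 1 = 0"
    and rec: "\<And>n. of_nat (n + 2) * of_nat (n + 1) * a (n + 2)
           = (of_nat n ^ 2 + 4 * z) * a n + (if n = 0 then 4 else 0)"
    and sums: "\<And>x. norm x < 1 \<Longrightarrow> (\<lambda>n. a n * x ^ n) sums cosh_sqrt_quot (Arcsin x) z"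
  proof (rule Arcsin_comp_coeffs[OF DERIV_cosh_sqrt_quot DERIV_cosh_sqrt_quot'])
    fix a
    assume "a 0 = cosh_sqrt_quot 0 z" "a 1 = 4 * (sinh_sqrt_quot 0 z * cosh_sqrt 0 z)"
      "\<And>n. of_nat (n + 2) * of_nat (n + 1) * a (n + 2)
           = (of_nat n ^ 2 + 4 * z) * a n + (if n = 0 then 4 else 0)"
      "\<And>x. norm x < 1 \<Longrightarrow> (\<lambda>n. a n * x ^ n) sums cosh_sqrt_quot (Arcsin x) z"
    thus thesis
      unfolding S0 C0 mult_zero_left mult_zero_right by (rule that[of a])
  qed
  have odd: "a (2 * n + 1) = 0" for n
  proof (induction n)
    case (Suc n)
    have "of_nat (2 * n + 3) * of_nat (2 * n + 2) * a (2 * n + 3) = 0"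
      using rec[of "2 * n + 1"] Suc by (simp add: eval_nat_numeral)
    hence "a (2 * n + 3) = 0"
      unfolding mult_eq_0_iff of_nat_eq_0_iff by simp
    thus ?case by (simp add: eval_nat_numeral)
  qed (use a1 in simp)
  have even: "a (2 * Suc k) * x ^ (2 * Suc k) = E_term z x (Suc k)" for k
  proof (induction k)
    case 0
    \<comment> \<open>The recurrence at 0 reads \<open>2 * a 2 = 4\<close>, and
      \<open>a 2 = 2\<close> is the coefficient of the first term.\<close>
    show ?case using rec[of 0] a0 by (simp add: E_term_def eval_nat_numeral)
  next
    case (Suc k)
    define n where "n = Suc k"
    have "(2 * of_nat n + 1) * (2 * of_nat n + 2) * a (2 * Suc n)
            = (4 * (of_nat n)\<^sup>2 + 4 * z) * a (2 * n)"
      \<comment> \<open>As \<open>n = Suc k\<close> is positive, the constant 4 no longer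
        enters.\<close>
      using rec[of "2 * n"] by (simp add: algebra_simps power2_eq_square n_def)
    hence "a (2 * Suc n) = (4 * (of_nat n)\<^sup>2 + 4 * z)
        / ((2 * of_nat n + 1) * (2 * of_nat n + 2)) * a (2 * n)"
      using of_nat_denoms_nonzero(2,3)[of n, where ?'a = complex]
      by (simp add: eq_divide_eq mult_ac del: mult_Suc_right)
    hence "a (2 * Suc n) * x ^ (2 * Suc n) = (4 * (of_nat n)\<^sup>2 + 4 * z)
        / ((2 * of_nat n + 1) * (2 * of_nat n + 2)) * x\<^sup>2 * (a (2 * n) * x ^ (2 * n))"
      by (simp add: power2_eq_square mult_ac)
    thus ?case
      using Suc.IH E_term_Suc[of n z x] by (simp only: n_def zero_less_Suc)
  qed
  have "(\<lambda>k. a (2 * Suc k) * x ^ (2 * Suc k)) sums cosh_sqrt_quot (Arcsin x) z"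
  \<comment> \<open>The reindexing skips index 0 along with the odd ones, which is harmless because
    \<open>a 0 = 0\<close>.\<close>
  proof (subst sums_mono_reindex[of "\<lambda>k. 2 * Suc k" "\<lambda>n. a n * x ^ n"])
    show "a n * x ^ n = 0" if "n \<notin> range (\<lambda>k. 2 * Suc k)" for n
    proof (cases "even n")
      case True
      then obtain m where "n = 2 * m" by (elim evenE)
      thus ?thesis using that a0 by (cases m) auto
    qed (use odd in \<open>auto elim!: oddE\<close>)
  qed (use sums[OF x] in \<open>auto simp: strict_mono_def\<close>)
  thus ?thesis
    unfolding even .
qed

section \<open>Holomorphy in \<open>z\<close>\<close>

lemma entire_power_series:
  fixes c :: "nat \<Rightarrow> complex"
  assumes "\<And>z. summable (\<lambda>n. c n * z ^ n)"
  shows "(\<lambda>z. \<Sum>n. c n * z ^ n) holomorphic_on UNIV"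
  using termdiffs_strong_converges_everywhere[OF assms] by (auto simp: holomorphic_on_open)

lemma summable_powser_at_0: "summable (\<lambda>n. c n * (0 :: 'a :: real_normed_field) ^ n)"
  by (rule sums_summable[OF powser_sums_zero])

text \<open>Convergence for every nonzero \<open>z\<close> is read off from the closed form; at 0
  every power series converges.\<close>

lemma sinh_sqrt_quot_entire: "sinh_sqrt_quot t holomorphic_on UNIV"
proof -
  have "summable (\<lambda>m. t ^ (2 * m + 1) / fact (2 * m + 1) * z ^ m)" for z
  proof (cases "z = 0")
    case True
    show ?thesis unfolding True by (rule summable_powser_at_0)
  next
    case False
    show ?thesis
      by (rule sums_summable[OF sinh_sqrt_quot_sums[OF power2_csqrt False]])
  qed
  thus ?thesis
    unfolding sinh_sqrt_quot_def[abs_def] by (rule entire_power_series)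
qed

lemma cosh_sqrt_quot_entire: "cosh_sqrt_quot t holomorphic_on UNIV"
proof -
  have "cosh_sqrt_quot t = (\<lambda>z. 2 * (sinh_sqrt_quot t z)\<^sup>2)"
    by (simp add: fun_eq_iff cosh_sqrt_quot_conv_sinh_sqrt_quot)
  thus ?thesis
    by (auto intro!: holomorphic_intros sinh_sqrt_quot_entire)
qed

section \<open>Normal convergence\<close>

text \<open>Weierstrass majorants: each supremum is at most \<open>M n\<close>, and for a
  nonnegative summable \<open>M\<close> the sum in \<open>ennreal\<close> is that of a real number,
  hence finite.\<close>

lemma normally_convergent_onI:
  assumes "summable M" and bound: "\<And>n s. s \<in> S \<Longrightarrow> norm (f n s) \<le> M n" and "\<And>n. 0 \<le> M n"
  shows "normally_convergent_on S f"
proof -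
  have "(\<Sum>n. SUP s\<in>S. ennreal (norm (f n s))) \<le> (\<Sum>n. ennreal (M n))"
    by (intro suminf_le SUP_least ennreal_leI bound) auto
  also have "\<dots> < top"
    using assms by (simp add: suminf_ennreal2)
  finally show ?thesis
    unfolding normally_convergent_on_def .
qed

lemma norm_one_plus_divide_le:
  fixes z :: complex
  assumes "norm z \<le> R"
  shows "norm (1 + z / (of_real d)\<^sup>2) \<le> 1 + R / d\<^sup>2"
  using norm_triangle_ineq[of 1 "z / (of_real d)\<^sup>2"] divide_right_mono[OF assms, of "d\<^sup>2"]
  by (simp add: norm_divide norm_power)

lemma normally_convergent_O_term:
  assumes "R \<ge> 0" "0 \<le> r" "r < 1"
  shows "normally_convergent_on (cball 0 R \<times> cball 0 r) (\<lambda>n (z, x). O_term z x n)"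
proof -
  define M where "M n = real ((2 * n) choose n) / (4 ^ n * (2 * real n + 1))
     * (\<Prod>j=1..n. 1 + R / (2 * real j - 1)\<^sup>2) * r ^ (2 * n + 1)" for n
  have M: "O_term (of_real R) (of_real r) n = of_real (M n)" for n
    by (simp add: O_term_def M_def)
  have r: "norm (of_real r :: complex) < 1"
    using assms by simp
  \<comment> \<open>\<open>M n\<close> is the term of the series at the real point
    \<open>(R, r)\<close>, so the summation result already proved gives summability.\<close>
  have "summable M"
    using sums_summable[OF O_term_sums[OF r, of "of_real R"]]
    unfolding M summable_of_real_iff .
  thus ?thesis
  proof (rule normally_convergent_onI)
    show "0 \<le> M n" for n
      unfolding M_def using assms by (intro mult_nonneg_nonneg prod_nonneg) auto
    have "norm (O_term z x n) \<le> M n" if z: "norm z \<le> R" and x: "norm x \<le> r" for n z x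
    proof -
      have factor: "norm (1 + z / (2 * of_nat j - 1)\<^sup>2) \<le> 1 + R / (2 * real j - 1)\<^sup>2" for j
        using norm_one_plus_divide_le[OF z, of "2 * real j - 1"] by simp
      have prod: "norm (\<Prod>j=1..n. 1 + z / (2 * of_nat j - 1)\<^sup>2) \<le> (\<Prod>j=1..n. 1 + R / (2 * real j - 1)\<^sup>2)"
        unfolding prod_norm[symmetric] by (intro prod_mono conjI norm_ge_zero factor)
      have coeff: "norm (of_nat ((2 * n) choose n) / (4 ^ n * (2 * of_nat n + 1)) :: complex)
                     = real ((2 * n) choose n) / (4 ^ n * (2 * real n + 1))"
        using norm_of_nat[of "2 * n + 1", where ?'a = complex]
        by (simp add: norm_divide norm_mult norm_power add.commute)
      show ?thesis
        unfolding O_term_def M_def norm_mult norm_power coeff using assms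
        by (intro mult_mono power_mono prod x mult_nonneg_nonneg prod_nonneg norm_ge_zero) auto
    qed
    thus "norm (case s of (z, x) \<Rightarrow> O_term z x n) \<le> M n" if "s \<in> cball 0 R \<times> cball 0 r" for n s
      using that by auto
  qed
qed

lemma normally_convergent_E_term:
  assumes "R \<ge> 0" "0 \<le> r" "r < 1"
  shows "normally_convergent_on (cball 0 R \<times> cball 0 r) (\<lambda>k (z, x). E_term z x (Suc k))"
proof -
  define M where "M n = 4 ^ n / (real n ^ 2 * real ((2 * n) choose n))
     * (\<Prod>j=1..<n. 1 + R / real j ^ 2) * r ^ (2 * n)" for n
  have M: "E_term (of_real R) (of_real r) n = of_real (M n)" for n
    by (simp add: E_term_def M_def)
  have r: "norm (of_real r :: complex) < 1"
    using assms by simp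
  have "summable (\<lambda>k. M (Suc k))"
    using sums_summable[OF E_term_sums[OF r, of "of_real R"]]
    unfolding M summable_of_real_iff .
  thus ?thesis
  proof (rule normally_convergent_onI)
    show "0 \<le> M (Suc k)" for k
      unfolding M_def using assms by (intro mult_nonneg_nonneg prod_nonneg) auto
    have "norm (E_term z x n) \<le> M n" if z: "norm z \<le> R" and x: "norm x \<le> r" for n z x
    proof -
      have factor: "norm (1 + z / (of_nat j)\<^sup>2) \<le> 1 + R / (real j)\<^sup>2" for j
        using norm_one_plus_divide_le[OF z, of "real j"] by simp
      have prod: "norm (\<Prod>j=1..<n. 1 + z / (of_nat j)\<^sup>2) \<le> (\<Prod>j=1..<n. 1 + R / (real j)\<^sup>2)"
        unfolding prod_norm[symmetric] by (intro prod_mono conjI norm_ge_zero factor)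
      have coeff: "norm (4 ^ n / (of_nat n ^ 2 * of_nat ((2 * n) choose n)) :: complex)
                     = 4 ^ n / (real n ^ 2 * real ((2 * n) choose n))"
        by (simp add: norm_divide norm_mult norm_power)
      show ?thesis
        unfolding E_term_def M_def norm_mult norm_power coeff using assms
        by (intro mult_mono power_mono prod x mult_nonneg_nonneg prod_nonneg norm_ge_zero) auto
    qed
    thus "norm (case s of (z, x) \<Rightarrow> E_term z x (Suc k)) \<le> M (Suc k)"
      if "s \<in> cball 0 R \<times> cball 0 r" for k s
      using that by auto
  qed
qed

lemma normally_convergent_on_subset:
  assumes "normally_convergent_on T f" "S \<subseteq> T"
  shows "normally_convergent_on S f"
proof -
  have "(\<Sum>n. SUP s\<in>S. ennreal (norm (f n s))) \<le> (\<Sum>n. SUP s\<in>T. ennreal (norm (f n s)))"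
    using assms(2) by (intro suminf_le SUP_subset_mono) auto
  thus ?thesis
    using assms(1) unfolding normally_convergent_on_def by (rule le_less_trans)
qed

theorem theorem2p3:
  shows "(\<forall>z x :: complex. norm x < 1 \<longrightarrow>
            O_series z x = sinh_sqrt_quot (Arcsin x) z \<and>
            E_series z x = cosh_sqrt_quot (Arcsin x) z) \<and>
         (\<forall>x :: complex. norm x < 1 \<longrightarrow>
            sinh_sqrt_quot (Arcsin x) holomorphic_on UNIV \<and>
            cosh_sqrt_quot (Arcsin x) holomorphic_on UNIV) \<and>
         (\<forall>(K :: complex set) (r :: real). compact K \<and> r < 1 \<longrightarrow>
            normally_convergent_on (K \<times> {x. norm x \<le> r}) (\<lambda>n (z, x). O_term z x n) \<and>
            normally_convergent_on (K \<times> {x. norm x \<le> r}) (\<lambda>k (z, x). E_term z x (Suc k)))"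
proof (intro conjI allI impI)
  fix z x :: complex assume x: "norm x < 1"
  show "O_series z x = sinh_sqrt_quot (Arcsin x) z"
    unfolding O_series_def using O_term_sums[OF x] by (rule sums_unique[symmetric])
  show "E_series z x = cosh_sqrt_quot (Arcsin x) z"
    unfolding E_series_def using E_term_sums[OF x] by (rule sums_unique[symmetric])
next
  fix x :: complex
  show "sinh_sqrt_quot (Arcsin x) holomorphic_on UNIV"
    by (rule sinh_sqrt_quot_entire)
  show "cosh_sqrt_quot (Arcsin x) holomorphic_on UNIV"
    by (rule cosh_sqrt_quot_entire)
next
  fix K :: "complex set" and r :: real
  assume K: "compact K \<and> r < 1"
  hence "bounded K"
    by (simp add: compact_imp_bounded)
  then obtain R where R: "\<And>z. z \<in> K \<Longrightarrow> norm z \<le> R" and "R > 0"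
    unfolding bounded_pos by blast
  \<comment> \<open>A negative \<open>r\<close> leaves no \<open>x\<close>; \<open>max 0 r\<close>
    supplies a radius that is nonnegative and still below 1.\<close>
  have sub: "K \<times> {x. norm x \<le> r} \<subseteq> cball 0 R \<times> cball 0 (max 0 r)"
    using R by auto
  show "normally_convergent_on (K \<times> {x. norm x \<le> r}) (\<lambda>n (z, x). O_term z x n)"
    using K \<open>R > 0\<close>
    by (intro normally_convergent_on_subset[OF _ sub] normally_convergent_O_term) auto
  show "normally_convergent_on (K \<times> {x. norm x \<le> r}) (\<lambda>k (z, x). E_term z x (Suc k))"
    using K \<open>R > 0\<close>
    by (intro normally_convergent_on_subset[OF _ sub] normally_convergent_E_term) auto
qed

end
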